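(* Let $(X,r)$ be a finite bijective left non-degenerate solution of the Yang--Baxter equation. Let $A=A(X,r)$ and $$\mathcal Z=\mathcal Z(X,r)=\{Z\subseteq X:\varnothing\ne Z\ne X\text{ and }\sigma_x(Z)=Z\text{ for all }x\in X\setminus Z\}.$$ Define $P(Z)=\bigcup_{z\in Z}Az$ for $Z\in\mathcal Z$. Then the maps $$\mathcal Z\to\operatorname{Spec}(A)\colon Z\mapsto P(Z)\qquad\text{and}\qquad\operatorname{Spec}(A)\to\mathcal Z\colon P\mapsto X\cap P$$ are mutually inverse bijections.
   Context: Let $X$ be a non-empty set. A (set-theoretic) solution of the Yang--Baxter equation is a pair $(X,r)$ with $r\colon X\times X\to X\times X$, written $r(x,y)=(\lambda_x(y),\rho_y(x))$, such that $(r\times\mathrm{id})(\mathrm{id}\times r)(r\times\mathrm{id})=(\mathrm{id}\times r)(r\times\mathrm{id})(\mathrm{id}\times r)$. It is finite if $X$ is finite, bijective if $r$ is bijective, left non-degenerate if every $\lambda_x\colon X\to X$ is bijective. For a left non-degenerate solution put $\sigma_z(x)=\lambda_z(\rho_{\lambda_x^{-1}(z)}(x))$ for $x,z\in X$; the derived structure monoid is $A(X,r)=\langle X\mid xz=z\sigma_z(x)\text{ for all }x,z\in X\rangle$. (If $(X,r)$ is bijective then each $\sigma_z\in\operatorname{Sym}(X)$.) $\operatorname{Spec}(A)$ denotes the prime spectrum of $A$, i.e., the set of prime ideals of the monoid $A$. A prime ideal of a monoid $A$ is a non-empty proper ideal $P$ such that $aAb\subseteq P$ implies $a\in P$ or $b\in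 P$, for $a,b\in A$.
   Formalization: The condition Z≠X is dropped, so Z=X is added to 𝒵: as stated the claim always fails, since A∖{1} is a prime ideal of A with X∩(A∖{1})=X (e.g. |X|=1: 𝒵 is empty but A=ℕ has the prime ideal ℕ∖{0}). *)

theory Defs
  imports "HOL-Algebra.Group"
begin

section \<open>Set-theoretic solutions of the Yang--Baxter equation\<close>

text \<open>A map \<open>r\<close> on \<open>X \<times> X\<close> is written \<open>r (x, y) = (\<lambda>\<^sub>x y, \<rho>\<^sub>y x)\<close>; note that \<open>rho r y x\<close> takes its
  index \<open>y\<close> first.\<close>

definition lam :: "('a \<times> 'a \<Rightarrow> 'a \<times> 'a) \<Rightarrow> 'a \<Rightarrow> 'a \<Rightarrow> 'a" where
  "lam r x y = fst (r (x, y))"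

definition rho :: "('a \<times> 'a \<Rightarrow> 'a \<times> 'a) \<Rightarrow> 'a \<Rightarrow> 'a \<Rightarrow> 'a" where
  "rho r y x = snd (r (x, y))"

definition times_id :: "('a \<times> 'a \<Rightarrow> 'a \<times> 'a) \<Rightarrow> 'a \<times> 'a \<times> 'a \<Rightarrow> 'a \<times> 'a \<times> 'a" where
  "times_id r = (\<lambda>(x, y, z). (fst (r (x, y)), snd (r (x, y)), z))"

definition id_times :: "('a \<times> 'a \<Rightarrow> 'a \<times> 'a) \<Rightarrow> 'a \<times> 'a \<times> 'a \<Rightarrow> 'a \<times> 'a \<times> 'a" where
  "id_times r = (\<lambda>(x, y, z). (x, r (y, z)))"

definition ybe_solution :: "'a set \<Rightarrow> ('a \<times> 'a \<Rightarrow> 'a \<times> 'a) \<Rightarrow> bool" where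
  "ybe_solution X r \<longleftrightarrow>
     X \<noteq> {} \<and> r \<in> X \<times> X \<rightarrow> X \<times> X \<and>
     (\<forall>t \<in> X \<times> X \<times> X.
        (times_id r \<circ> id_times r \<circ> times_id r) t = (id_times r \<circ> times_id r \<circ> id_times r) t)"

definition bijective_solution :: "'a set \<Rightarrow> ('a \<times> 'a \<Rightarrow> 'a \<times> 'a) \<Rightarrow> bool" where
  "bijective_solution X r \<longleftrightarrow> ybe_solution X r \<and> bij_betw r (X \<times> X) (X \<times> X)"

definition left_nondegenerate :: "'a set \<Rightarrow> ('a \<times> 'a \<Rightarrow> 'a \<times> 'a) \<Rightarrow> bool" where
  "left_nondegenerate X r \<longleftrightarrow> (\<forall>x \<in> X. bij_betw (lam r x) X X)"

definition sigma :: "'a set \<Rightarrow> ('a \<times> 'a \<Rightarrow> 'a \<times> 'a) \<Rightarrow> 'a \<Rightarrow> 'a \<Rightarrow> 'a" where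
  "sigma X r z x = lam r z (rho r (inv_into X (lam r x) z) x)"


section \<open>Monoids given by generators and relations\<close>

text \<open>The least congruence on the free monoid \<open>lists X\<close> that contains \<open>R\<close>.\<close>

inductive_set monoid_cong :: "'a set \<Rightarrow> ('a list \<times> 'a list) set \<Rightarrow> ('a list \<times> 'a list) set"
  for X :: "'a set" and R :: "('a list \<times> 'a list) set" where
  rel: "(u, v) \<in> R \<Longrightarrow> u \<in> lists X \<Longrightarrow> v \<in> lists X \<Longrightarrow> (u, v) \<in> monoid_cong X R"
| refl: "u \<in> lists X \<Longrightarrow> (u, u) \<in> monoid_cong X R"
| sym: "(u, v) \<in> monoid_cong X R \<Longrightarrow> (v, u) \<in> monoid_cong X R"
| trans: "(u, v) \<in> monoid_cong X R \<Longrightarrow> (v, w) \<in> monoid_cong X R \<Longrightarrow> (u, w) \<in> monoid_cong X R"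
| mult: "(u, v) \<in> monoid_cong X R \<Longrightarrow> (u', v') \<in> monoid_cong X R \<Longrightarrow>
           (u @ u', v @ v') \<in> monoid_cong X R"

definition presented_monoid :: "'a set \<Rightarrow> ('a list \<times> 'a list) set \<Rightarrow> 'a list set monoid" where
  "presented_monoid X R =
     \<lparr>carrier = lists X // monoid_cong X R,
      mult = (\<lambda>a b. \<Union>u \<in> a. \<Union>v \<in> b. monoid_cong X R `` {u @ v}),
      one = monoid_cong X R `` {[]}\<rparr>"

definition derived_rels :: "'a set \<Rightarrow> ('a \<times> 'a \<Rightarrow> 'a \<times> 'a) \<Rightarrow> ('a list \<times> 'a list) set" where
  "derived_rels X r = {([x, z], [z, sigma X r z x]) | x z. x \<in> X \<and> z \<in> X}"

definition derived_monoid :: "'a set \<Rightarrow> ('a \<times> 'a \<Rightarrow> 'a \<times> 'a) \<Rightarrow> 'a list set monoid" where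
  "derived_monoid X r = presented_monoid X (derived_rels X r)"

definition gen :: "'a set \<Rightarrow> ('a \<times> 'a \<Rightarrow> 'a \<times> 'a) \<Rightarrow> 'a \<Rightarrow> 'a list set" where
  "gen X r x = monoid_cong X (derived_rels X r) `` {[x]}"


section \<open>Prime ideals of a monoid\<close>

definition monoid_ideal :: "('m, 'b) monoid_scheme \<Rightarrow> 'm set \<Rightarrow> bool" where
  "monoid_ideal A P \<longleftrightarrow>
     P \<subseteq> carrier A \<and>
     (\<forall>a \<in> carrier A. \<forall>p \<in> P. a \<otimes>\<^bsub>A\<^esub> p \<in> P \<and> p \<otimes>\<^bsub>A\<^esub> a \<in> P)"

definition monoid_prime_ideal :: "('m, 'b) monoid_scheme \<Rightarrow> 'm set \<Rightarrow> bool" where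
  "monoid_prime_ideal A P \<longleftrightarrow>
     monoid_ideal A P \<and> P \<noteq> {} \<and> P \<noteq> carrier A \<and>
     (\<forall>a \<in> carrier A. \<forall>b \<in> carrier A.
        {a \<otimes>\<^bsub>A\<^esub> c \<otimes>\<^bsub>A\<^esub> b | c. c \<in> carrier A} \<subseteq> P \<longrightarrow> a \<in> P \<or> b \<in> P)"

definition monoid_Spec :: "('m, 'b) monoid_scheme \<Rightarrow> 'm set set" where
  "monoid_Spec A = {P. monoid_prime_ideal A P}"


section \<open>The correspondence\<close>

definition ZZ :: "'a set \<Rightarrow> ('a \<times> 'a \<Rightarrow> 'a \<times> 'a) \<Rightarrow> 'a set set" where
  "ZZ X r = {Z. Z \<subseteq> X \<and> Z \<noteq> {} \<and> Z \<noteq> X \<and> (\<forall>x \<in> X - Z. sigma X r x ` Z = Z)}"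

definition PP :: "'a set \<Rightarrow> ('a \<times> 'a \<Rightarrow> 'a \<times> 'a) \<Rightarrow> 'a set \<Rightarrow> 'a list set set" where
  "PP X r Z = (\<Union>z \<in> Z. {a \<otimes>\<^bsub>derived_monoid X r\<^esub> gen X r z | a. a \<in> carrier (derived_monoid X r)})"

text \<open>The intersection of \<open>X\<close> with \<open>P\<close>, where \<open>X\<close> is identified with its image in the
  derived structure monoid.\<close>

definition XX :: "'a set \<Rightarrow> ('a \<times> 'a \<Rightarrow> 'a \<times> 'a) \<Rightarrow> 'a list set set \<Rightarrow> 'a set" where
  "XX X r P = {x \<in> X. gen X r x \<in> P}"

section \<open>The prime ideal of non-units\<close>

text \<open>The defining relations preserve length, so the elements other than \<open>1\<close> form a prime ideal,
  which contains all of \<open>X\<close>. As \<open>X\<close> itself is not in \<open>ZZ X r\<close>, the map \<open>P \<mapsto> X \<inter> P\<close> on the whole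
  spectrum never takes all its values in \<open>ZZ X r\<close>; the correspondence therefore has to be stated
  for \<open>insert X (ZZ X r)\<close>, that is, without the requirement \<open>Z \<noteq> X\<close> (the other requirements hold
  for \<open>Z = X\<close>).\<close>

lemma monoid_cong_in_lists: "(u,v) \<in> monoid_cong X R \<Longrightarrow> u \<in> lists X \<and> v \<in> lists X"
  by (induction rule: monoid_cong.induct) auto

lemma derived_cong_length: "(u,v) \<in> monoid_cong X (derived_rels X r) \<Longrightarrow> length u = length v"
  by (induction rule: monoid_cong.induct) (auto simp: derived_rels_def)

lemma monoid_cong_equiv: "equiv (lists X) (monoid_cong X R)"
  unfolding equiv_def refl_on_def sym_def trans_def
  by (auto dest: monoid_cong_in_lists intro: monoid_cong.intros)

lemma derived_monoid_mult: assumes "u \<in> lists X" "v \<in> lists X"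
  shows "(monoid_cong X (derived_rels X r) `` {u}) \<otimes>\<^bsub>derived_monoid X r\<^esub> (monoid_cong X (derived_rels X r) `` {v})
     = monoid_cong X (derived_rels X r) `` {u @ v}" (is "?L = ?R")
proof -
  let ?C = "monoid_cong X (derived_rels X r)"
  have cls: "?C `` {u' @ v'} = ?C `` {u @ v}" if "u' \<in> ?C `` {u}" "v' \<in> ?C `` {v}" for u' v'
    using equiv_class_eq[OF monoid_cong_equiv monoid_cong.mult[of u u' X _ v v']] that by simp
  have ne: "?C `` {u} \<noteq> {}" "?C `` {v} \<noteq> {}" using assms by (auto intro: monoid_cong.refl)
  have "?L = (\<Union>u' \<in> ?C `` {u}. \<Union>v' \<in> ?C `` {v}. ?C `` {u' @ v'})"
    by (simp add: derived_monoid_def presented_monoid_def)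
  also have "\<dots> = (\<Union>u' \<in> ?C `` {u}. \<Union>v' \<in> ?C `` {v}. ?R)"
    by (intro SUP_cong HOL.refl cls)
  also have "\<dots> = ?R" using ne by simp
  finally show ?thesis .
qed

lemma nonunits_prime:
  assumes "ybe_solution X r"
  defines "A \<equiv> derived_monoid X r"
  defines "P \<equiv> carrier A - {\<one>\<^bsub>A\<^esub>}"
  shows "P \<in> monoid_Spec A" "XX X r P = X" "XX X r P \<notin> ZZ X r"
proof -
  let ?C = "monoid_cong X (derived_rels X r)"
  have one: "\<one>\<^bsub>A\<^esub> = ?C `` {[]}" and car: "carrier A = lists X // ?C"
    by (auto simp: A_def derived_monoid_def presented_monoid_def)
  have cls: "(?C `` {u} = \<one>\<^bsub>A\<^esub>) = (u = [])" if "u \<in> lists X" for u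
  proof
    assume "?C `` {u} = \<one>\<^bsub>A\<^esub>"
    then have "(u, []) \<in> ?C" using that one by (metis Image_singleton_iff lists.Nil monoid_cong.refl)
    then show "u = []" using derived_cong_length by fastforce
  qed (simp add: one)
  have mem: "?C `` {u} \<in> carrier A" if "u \<in> lists X" for u using that car by (auto intro: quotientI)
  have rep: "\<exists>u \<in> lists X. a = ?C `` {u}" if "a \<in> carrier A" for a using that car by (auto elim: quotientE)
  have mm: "?C `` {u} \<otimes>\<^bsub>A\<^esub> ?C `` {v} = ?C `` {u @ v}" if "u \<in> lists X" "v \<in> lists X" for u v
    using derived_monoid_mult[OF that] A_def by simp
  have id: "monoid_ideal A P" unfolding monoid_ideal_def
  proof (intro conjI ballI)
    show "P \<subseteq> carrier A" by (auto simp: P_def)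
    fix a p assume "a \<in> carrier A" "p \<in> P"
    then obtain u v where uv: "u \<in> lists X" "v \<in> lists X" "a = ?C `` {u}" "p = ?C `` {v}" "v \<noteq> []"
      unfolding P_def using rep cls by (metis DiffD1 DiffD2 insertCI)
    have "u @ v \<in> lists X" "v @ u \<in> lists X" using uv by auto
    then show "a \<otimes>\<^bsub>A\<^esub> p \<in> P" "p \<otimes>\<^bsub>A\<^esub> a \<in> P" unfolding P_def
      using uv mm[OF uv(1,2)] mm[OF uv(2,1)] cls[of "u @ v"] cls[of "v @ u"] mem[of "u @ v"] mem[of "v @ u"] by auto
  qed
  obtain x where x: "x \<in> X" using assms by (auto simp: ybe_solution_def)
  have gP: "gen X r y \<in> P" if "y \<in> X" for y
    using that mem[of "[y]"] cls[of "[y]"] by (auto simp: P_def gen_def)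
  have oneA: "\<one>\<^bsub>A\<^esub> \<in> carrier A" using mem[of "[]"] one by simp
  have o1: "\<one>\<^bsub>A\<^esub> \<otimes>\<^bsub>A\<^esub> \<one>\<^bsub>A\<^esub> = \<one>\<^bsub>A\<^esub>" using mm[of "[]" "[]"] one by simp
  have "a \<in> P \<or> b \<in> P" if "a \<in> carrier A" "b \<in> carrier A"
    "{a \<otimes>\<^bsub>A\<^esub> c \<otimes>\<^bsub>A\<^esub> b | c. c \<in> carrier A} \<subseteq> P" for a b
  proof (rule ccontr)
    assume "\<not> ?thesis"
    then have "a = \<one>\<^bsub>A\<^esub>" "b = \<one>\<^bsub>A\<^esub>" using that by (auto simp: P_def)
    then have "\<one>\<^bsub>A\<^esub> \<in> P" using that(3) oneA o1 by force
    then show False by (simp add: P_def)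
  qed
  then show "P \<in> monoid_Spec A" unfolding monoid_Spec_def monoid_prime_ideal_def
    using id gP[OF x] oneA by (auto simp: P_def)
  show X: "XX X r P = X" using gP by (auto simp: XX_def)
  show "XX X r P \<notin> ZZ X r" unfolding X by (simp add: ZZ_def)
qed
end

theory Submission
  imports Defs
begin

text \<open>
  Write \<open>A\<close> for the derived monoid. Reading \<open>xz = z\<sigma>\<^sub>z(x)\<close> from left to right moves any letter \<open>z\<close>
  to the left, so \<open>Ab \<subseteq> bA\<close> for all \<open>b\<close>; hence prime ideals of \<open>A\<close> are completely prime
  and are determined by the generators they contain. If \<open>P\<close> is prime, \<open>z \<in> P\<close> and \<open>x \<notin> P\<close>, then
  \<open>x\<sigma>\<^sub>x(z) = zx \<in> P\<close> gives \<open>\<sigma>\<^sub>x(z) \<in> P\<close>; injectivity of \<open>\<sigma>\<^sub>x\<close> and finiteness do the rest.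
  Conversely, for \<open>Z \<in> \<Z>\<close> the property of containing a letter of \<open>Z\<close> is invariant under the
  relations, and the last such letter of a word can be moved to its right end without leaving
  \<open>Z\<close>, so \<open>P(Z)\<close> consists of the words that contain a letter of \<open>Z\<close>. Only the
  injectivity of the \<open>\<sigma>\<^sub>x\<close> is used, not the rack identity.
\<close>

locale finite_solution =
  fixes X :: "'a set" and r :: "'a \<times> 'a \<Rightarrow> 'a \<times> 'a"
  assumes finite_X: "finite X"
    and bijective: "bijective_solution X r"
    and left_nondeg: "left_nondegenerate X r"
begin

abbreviation cong :: "'a list \<Rightarrow> 'a list \<Rightarrow> bool" (infix \<open>\<sim>\<close> 50) where
  "u \<sim> v \<equiv> (u, v) \<in> monoid_cong X (derived_rels X r)"

abbreviation cls :: "'a list \<Rightarrow> 'a list set" where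
  "cls u \<equiv> monoid_cong X (derived_rels X r) `` {u}"

abbreviation A :: "'a list set monoid" where
  "A \<equiv> derived_monoid X r"

abbreviation \<sigma> :: "'a \<Rightarrow> 'a \<Rightarrow> 'a" where
  "\<sigma> \<equiv> sigma X r"

abbreviation words_meeting :: "'a set \<Rightarrow> 'a list set" where
  "words_meeting Z \<equiv> {u \<in> lists X. set u \<inter> Z \<noteq> {}}"

section \<open>Injectivity of the maps \<open>\<sigma> z\<close>\<close>

lemma inv_lam:
  assumes "x \<in> X" "z \<in> X"
  shows "inv_into X (lam r x) z \<in> X" "lam r x (inv_into X (lam r x) z) = z"
proof -
  have "z \<in> lam r x ` X"
    using assms left_nondeg by (auto simp: left_nondegenerate_def bij_betw_def)
  then show "inv_into X (lam r x) z \<in> X" "lam r x (inv_into X (lam r x) z) = z"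
    by (rule inv_into_into, rule f_inv_into_f)
qed

lemma rho_closed: "x \<in> X \<Longrightarrow> y \<in> X \<Longrightarrow> rho r y x \<in> X"
  using bijective unfolding bijective_solution_def ybe_solution_def rho_def
  by (metis PiE SigmaI mem_Times_iff)

lemma sigma_closed: "x \<in> X \<Longrightarrow> z \<in> X \<Longrightarrow> \<sigma> z x \<in> X"
  using left_nondeg inv_lam rho_closed unfolding sigma_def left_nondegenerate_def
  by (metis bij_betw_apply)

lemma sigma_inj:
  assumes z: "z \<in> X"
  shows "inj_on (\<sigma> z) X"
proof (rule inj_onI)
  fix x x' assume x: "x \<in> X" "x' \<in> X" and eq: "\<sigma> z x = \<sigma> z x'"
  \<comment> \<open>\<open>y\<close> is the second argument for which the first component of
    \<open>r (x, y)\<close> is \<open>z\<close>. Applying \<open>lam r z\<close> to the second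
    component then gives \<open>\<sigma> z x\<close>, so \<open>\<sigma> z x\<close> and
    \<open>z\<close> together determine \<open>r (x, y)\<close>, and injectivity of \<open>r\<close>
    recovers \<open>x\<close>.\<close>
  define y y' where y: "y = inv_into X (lam r x) z" "y' = inv_into X (lam r x') z"
  have yX: "y \<in> X" "y' \<in> X" and lam: "lam r x y = z" "lam r x' y' = z"
    using inv_lam x z by (simp_all add: y)
  have "inj_on (lam r z) X"
    using left_nondeg z by (auto simp: left_nondegenerate_def bij_betw_def)
  moreover have "lam r z (rho r y x) = lam r z (rho r y' x')"
    using eq by (simp add: sigma_def y)
  ultimately have "rho r y x = rho r y' x'"
    using rho_closed x yX by (meson inj_onD)
  with lam have "r (x, y) = r (x', y')"
    by (simp add: lam_def rho_def prod_eq_iff)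
  moreover have "inj_on r (X \<times> X)"
    using bijective by (simp add: bijective_solution_def bij_betw_def)
  ultimately show "x = x'"
    using x yX by (auto dest: inj_onD)
qed

section \<open>Computing with words modulo the relations\<close>

lemma cls_eq_iff: "u \<in> lists X \<Longrightarrow> v \<in> lists X \<Longrightarrow> cls u = cls v \<longleftrightarrow> u \<sim> v"
  by (rule eq_equiv_class_iff[OF monoid_cong_equiv])

lemma cls_carrier: "u \<in> lists X \<Longrightarrow> cls u \<in> carrier A"
  by (auto simp: derived_monoid_def presented_monoid_def intro: quotientI)

lemma carrierE:
  assumes "a \<in> carrier A"
  obtains u where "u \<in> lists X" "a = cls u"
proof -
  have "a \<in> lists X // monoid_cong X (derived_rels X r)"
    using assms by (simp add: derived_monoid_def presented_monoid_def)
  then show thesis by (rule quotientE) (rule that)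
qed

lemma cls_mult: "u \<in> lists X \<Longrightarrow> v \<in> lists X \<Longrightarrow> cls u \<otimes>\<^bsub>A\<^esub> cls v = cls (u @ v)"
  by (rule derived_monoid_mult)

lemma cong_append_left: "w \<in> lists X \<Longrightarrow> u \<sim> v \<Longrightarrow> w @ u \<sim> w @ v"
  by (intro monoid_cong.mult monoid_cong.refl)

lemma cong_append_right: "w \<in> lists X \<Longrightarrow> u \<sim> v \<Longrightarrow> u @ w \<sim> v @ w"
  by (intro monoid_cong.mult monoid_cong.refl)

lemma cong_swap: "x \<in> X \<Longrightarrow> z \<in> X \<Longrightarrow> [x, z] \<sim> [z, \<sigma> z x]"
  by (rule monoid_cong.rel) (auto simp: derived_rels_def sigma_closed)

text \<open>The moving letter stays \<open>z\<close>, while every letter it passes is changed by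
  \<open>\<sigma> z\<close>. In the induction, \<open>z\<close> crosses the tail first and the head
  last.\<close>

lemma move_letter_left:
  "w \<in> lists X \<Longrightarrow> z \<in> X \<Longrightarrow> w @ [z] \<sim> z # map (\<sigma> z) w"
proof (induction w)
  case (Cons x w)
  have "[x] @ (w @ [z]) \<sim> [x] @ (z # map (\<sigma> z) w)"
    using Cons by (intro cong_append_left) auto
  moreover have "[x, z] @ map (\<sigma> z) w \<sim> [z, \<sigma> z x] @ map (\<sigma> z) w"
    using Cons.prems by (intro cong_append_right cong_swap) (auto simp: sigma_closed)
  ultimately show ?case
    using monoid_cong.trans by fastforce
qed (auto intro: monoid_cong.refl)

text \<open>This is the inclusion of \<open>Ab\<close> in \<open>bA\<close> on the level of words.
  The first letter of \<open>v\<close> crosses first, so the rest of \<open>v\<close> meets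
  \<open>map (\<sigma> z) w\<close> instead of \<open>w\<close>; hence the induction is over
  arbitrary \<open>w\<close>.\<close>

lemma move_word_left:
  "v \<in> lists X \<Longrightarrow> w \<in> lists X \<Longrightarrow> \<exists>w' \<in> lists X. w @ v \<sim> v @ w'"
proof (induction v arbitrary: w)
  case Nil
  then show ?case by (auto intro!: bexI[of _ w] monoid_cong.refl)
next
  case (Cons z v)
  have w: "map (\<sigma> z) w \<in> lists X" using Cons.prems by (auto simp: sigma_closed)
  then obtain w' where w': "w' \<in> lists X" "map (\<sigma> z) w @ v \<sim> v @ w'"
    using Cons.IH Cons.prems by (metis Cons_in_lists_iff)
  have "(w @ [z]) @ v \<sim> (z # map (\<sigma> z) w) @ v"
    using Cons.prems by (intro cong_append_right move_letter_left) auto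
  moreover have "[z] @ (map (\<sigma> z) w @ v) \<sim> [z] @ (v @ w')"
    using Cons.prems w' by (intro cong_append_left) auto
  ultimately have "w @ z # v \<sim> (z # v) @ w'"
    using monoid_cong.trans by fastforce
  with w' show ?case by auto
qed

section \<open>Prime ideals are determined by their generators\<close>

lemma prime_completely_prime:
  assumes P: "P \<in> monoid_Spec A"
    and u: "u \<in> lists X" and v: "v \<in> lists X" and uv: "cls (u @ v) \<in> P"
  shows "cls u \<in> P \<or> cls v \<in> P"
proof -
  \<comment> \<open>Moving \<open>v\<close> to the left across a representative of \<open>c\<close>
    turns the product into a right multiple of \<open>cls (u @ v)\<close>, which lies in the
    ideal.\<close>
  have "cls u \<otimes>\<^bsub>A\<^esub> c \<otimes>\<^bsub>A\<^esub> cls v \<in> P" if "c \<in> carrier A" for c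
  proof -
    obtain w where w: "w \<in> lists X" "c = cls w" using \<open>c \<in> carrier A\<close> by (rule carrierE)
    obtain w' where w': "w' \<in> lists X" "w @ v \<sim> v @ w'"
      using move_word_left[OF v w(1)] by auto
    have "u @ (w @ v) \<sim> u @ (v @ w')"
      using u w' by (intro cong_append_left)
    then have "cls (u @ w @ v) = cls ((u @ v) @ w')"
      using u v w w' by (subst cls_eq_iff) simp_all
    also have "\<dots> = cls (u @ v) \<otimes>\<^bsub>A\<^esub> cls w'"
      using u v w' by (subst cls_mult) auto
    also have "\<dots> \<in> P"
      using P uv cls_carrier[OF w'(1)]
      by (auto simp: monoid_Spec_def monoid_prime_ideal_def monoid_ideal_def)
    finally show ?thesis
      using u v w by (simp add: cls_mult)
  qed
  then show ?thesis
    using P cls_carrier[OF u] cls_carrier[OF v]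
    unfolding monoid_Spec_def monoid_prime_ideal_def by blast
qed

lemma prime_mult:
  assumes P: "P \<in> monoid_Spec A" and u: "u \<in> lists X" and v: "v \<in> lists X"
  shows "cls (u @ v) \<in> P \<longleftrightarrow> cls u \<in> P \<or> cls v \<in> P"
proof
  assume "cls u \<in> P \<or> cls v \<in> P"
  moreover have "monoid_ideal A P"
    using P by (simp add: monoid_Spec_def monoid_prime_ideal_def)
  ultimately show "cls (u @ v) \<in> P"
    using cls_mult[OF u v] cls_carrier[OF u] cls_carrier[OF v] unfolding monoid_ideal_def by metis
qed (rule prime_completely_prime[OF assms])

lemma prime_Nil:
  assumes P: "P \<in> monoid_Spec A"
  shows "cls [] \<notin> P"
proof
  assume "cls [] \<in> P"
  moreover have sub: "P \<subseteq> carrier A" "P \<noteq> carrier A"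
    using P by (auto simp: monoid_Spec_def monoid_prime_ideal_def monoid_ideal_def)
  ultimately have "cls u \<in> P" if "u \<in> lists X" for u
    using prime_mult[OF P that, of "[]"] by simp
  then have "carrier A \<subseteq> P" by (metis carrierE subsetI)
  with sub show False by auto
qed

text \<open>\<open>prime_mult\<close> splits off one letter at a time, and the empty word is settled
  by \<open>prime_Nil\<close>. Thus \<open>P\<close> can be recovered from
  \<open>XX X r P\<close>.\<close>

lemma cls_mem_prime_iff:
  assumes P: "P \<in> monoid_Spec A"
  shows "u \<in> lists X \<Longrightarrow> cls u \<in> P \<longleftrightarrow> set u \<inter> XX X r P \<noteq> {}"
proof (induction u)
  case (Cons x u)
  then show ?case
    using prime_mult[OF P, of "[x]" u] by (auto simp: XX_def gen_def)
qed (simp add: prime_Nil[OF P])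

lemma prime_eq_words_meeting:
  assumes P: "P \<in> monoid_Spec A"
  shows "P = cls ` words_meeting (XX X r P)"
proof -
  have "P \<subseteq> carrier A"
    using P by (simp add: monoid_Spec_def monoid_prime_ideal_def monoid_ideal_def)
  show ?thesis
  proof (intro equalityI subsetI)
    fix p assume "p \<in> P"
    moreover from this \<open>P \<subseteq> carrier A\<close> obtain u where "u \<in> lists X" "p = cls u"
      by (meson carrierE subsetD)
    ultimately show "p \<in> cls ` words_meeting (XX X r P)"
      using cls_mem_prime_iff[OF P] by blast
  next
    fix p assume "p \<in> cls ` words_meeting (XX X r P)"
    then show "p \<in> P" using cls_mem_prime_iff[OF P] by blast
  qed
qed

lemma XX_prime:
  assumes P: "P \<in> monoid_Spec A"
  shows "XX X r P \<in> insert X (ZZ X r)"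
proof -
  let ?Z = "XX X r P"
  have sub: "?Z \<subseteq> X" by (auto simp: XX_def)
  have "P \<noteq> {}" using P by (simp add: monoid_Spec_def monoid_prime_ideal_def)
  then have ne: "?Z \<noteq> {}" using prime_eq_words_meeting[OF P] by auto
  have "\<sigma> x ` ?Z = ?Z" if x: "x \<in> X - ?Z" for x
  \<comment> \<open>An injective self-map of a finite set is onto, so only invariance of the set
    under \<open>\<sigma> x\<close> needs proof.\<close>
  proof (rule endo_inj_surj)
    show "finite ?Z" using sub finite_X by (rule finite_subset)
    show "inj_on (\<sigma> x) ?Z" using sigma_inj x sub by (meson DiffD1 inj_on_subset)
    show "\<sigma> x ` ?Z \<subseteq> ?Z"
    proof (rule image_subsetI)
      fix z assume z: "z \<in> ?Z"
      have w: "[z, x] \<in> lists X" "[x, \<sigma> x z] \<in> lists X"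
        using z x sub by (auto simp: sigma_closed)
      have "cls [z, x] = cls [x, \<sigma> x z]"
        using cong_swap z x sub by (subst cls_eq_iff[OF w]) auto
      \<comment> \<open>Both words represent the same element of \<open>P\<close>, and
        \<open>x\<close> is not among the generators in \<open>P\<close>; the other letter must
        be.\<close>
      then have "set [x, \<sigma> x z] \<inter> ?Z \<noteq> {}"
        using cls_mem_prime_iff[OF P w(1)] cls_mem_prime_iff[OF P w(2)] z by simp
      then show "\<sigma> x z \<in> ?Z" using x by auto
    qed
  qed
  then show ?thesis using sub ne by (auto simp: ZZ_def)
qed

section \<open>From invariant sets to prime ideals\<close>

lemma ZZ_sigma_mem_iff:
  assumes Z: "Z \<in> insert X (ZZ X r)" and x: "x \<in> X" and z: "z \<in> X - Z"
  shows "\<sigma> z x \<in> Z \<longleftrightarrow> x \<in> Z"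
proof -
  \<comment> \<open>For \<open>Z = X\<close> the assumption on \<open>z\<close> is
    contradictory.\<close>
  have "\<sigma> z ` Z = Z" "Z \<subseteq> X" using Z z by (auto simp: ZZ_def)
  moreover have "inj_on (\<sigma> z) X" using z by (intro sigma_inj) auto
  ultimately show ?thesis using x inj_on_image_mem_iff by metis
qed

text \<open>Only the defining relations need an argument: if \<open>z\<close> is in
  \<open>Z\<close>, both sides meet \<open>Z\<close>; otherwise \<open>\<sigma> z\<close> preserves
  both \<open>Z\<close> and its complement in \<open>X\<close>.\<close>

lemma cong_words_meeting:
  assumes Z: "Z \<in> insert X (ZZ X r)"
  shows "u \<sim> v \<Longrightarrow> set u \<inter> Z \<noteq> {} \<longleftrightarrow> set v \<inter> Z \<noteq> {}"
proof (induction rule: monoid_cong.induct)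
  case (rel u v)
  then obtain x z where "x \<in> X" "z \<in> X" "u = [x, z]" "v = [z, \<sigma> z x]"
    by (auto simp: derived_rels_def)
  then show ?case using ZZ_sigma_mem_iff[OF Z, of x z] by (cases "z \<in> Z") auto
qed auto

lemma cls_mem_words_meeting:
  assumes Z: "Z \<in> insert X (ZZ X r)" and u: "u \<in> lists X"
  shows "cls u \<in> cls ` words_meeting Z \<longleftrightarrow> set u \<inter> Z \<noteq> {}"
proof
  assume "cls u \<in> cls ` words_meeting Z"
  then obtain v where "v \<in> lists X" "set v \<inter> Z \<noteq> {}" "cls u = cls v" by blast
  with u show "set u \<inter> Z \<noteq> {}" using cong_words_meeting[OF Z, of u v] cls_eq_iff by blast
qed (use u in blast)

text \<open>A last letter \<open>y\<close> outside \<open>Z\<close> is moved left past the letter of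
  \<open>Z\<close> that the induction hypothesis puts before it; that letter becomes
  \<open>\<sigma> y z\<close>, still in \<open>Z\<close>.\<close>

lemma cong_ends_in:
  assumes Z: "Z \<in> insert X (ZZ X r)"
  shows "u \<in> lists X \<Longrightarrow> set u \<inter> Z \<noteq> {} \<Longrightarrow> \<exists>v \<in> lists X. \<exists>z \<in> Z. u \<sim> v @ [z]"
proof (induction u rule: rev_induct)
  case (snoc y u)
  show ?case
  proof (cases "y \<in> Z")
    case True
    then show ?thesis using snoc.prems by (auto intro!: bexI[of _ u] bexI[of _ y] monoid_cong.refl)
  next
    case False
    then obtain v z where v: "v \<in> lists X" "z \<in> Z" "u \<sim> v @ [z]"
      using snoc by auto
    have y: "y \<in> X" using snoc.prems by auto
    have "z \<in> X" using v Z by (auto simp: ZZ_def)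
    have "u @ [y] \<sim> (v @ [z]) @ [y]"
      using v y by (intro cong_append_right) auto
    moreover have "v @ [z, y] \<sim> v @ [y, \<sigma> y z]"
      using v y \<open>z \<in> X\<close> by (intro cong_append_left cong_swap)
    ultimately have "u @ [y] \<sim> (v @ [y]) @ [\<sigma> y z]"
      using monoid_cong.trans by fastforce
    moreover have "\<sigma> y z \<in> Z" using ZZ_sigma_mem_iff[OF Z \<open>z \<in> X\<close>] v y False by auto
    moreover have "v @ [y] \<in> lists X" using v y by auto
    ultimately show ?thesis by blast
  qed
qed simp

text \<open>\<open>PP\<close> is by definition only a left ideal. The description by words is
  symmetric in left and right and turns primality into a statement about letters.\<close>

lemma PP_eq_words_meeting:
  assumes Z: "Z \<in> insert X (ZZ X r)"
  shows "PP X r Z = cls ` words_meeting Z"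
proof (intro equalityI subsetI)
  have sub: "Z \<subseteq> X" using Z by (auto simp: ZZ_def)
  {
    fix p assume "p \<in> PP X r Z"
    then obtain a z where a: "a \<in> carrier A" and z: "z \<in> Z" and p: "p = a \<otimes>\<^bsub>A\<^esub> cls [z]"
      by (auto simp: PP_def gen_def)
    obtain u where u: "u \<in> lists X" "a = cls u" using a by (rule carrierE)
    have "[z] \<in> lists X" using z sub by auto
    then have "p = cls (u @ [z])" using u p cls_mult by blast
    moreover have "u @ [z] \<in> words_meeting Z" using u z sub by auto
    ultimately show "p \<in> cls ` words_meeting Z" by blast
  }
  fix p assume "p \<in> cls ` words_meeting Z"
  then obtain u where u: "u \<in> lists X" "set u \<inter> Z \<noteq> {}" "p = cls u" by auto
  then obtain v z where v: "v \<in> lists X" "z \<in> Z" "u \<sim> v @ [z]"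
    using cong_ends_in[OF Z] by blast
  have "[z] \<in> lists X" "v @ [z] \<in> lists X" using v sub by auto
  then have "p = cls v \<otimes>\<^bsub>A\<^esub> gen X r z"
    using u v cls_mult[of v "[z]"] cls_eq_iff[of u "v @ [z]"] by (simp add: gen_def)
  then show "p \<in> PP X r Z" using v cls_carrier by (auto simp: PP_def)
qed

lemma XX_PP:
  assumes Z: "Z \<in> insert X (ZZ X r)"
  shows "XX X r (PP X r Z) = Z"
proof -
  have "Z \<subseteq> X" using Z by (auto simp: ZZ_def)
  moreover have "gen X r x \<in> PP X r Z \<longleftrightarrow> x \<in> Z" if "x \<in> X" for x
    using cls_mem_words_meeting[OF Z, of "[x]"] that PP_eq_words_meeting[OF Z]
    by (simp add: gen_def)
  ultimately show ?thesis by (auto simp: XX_def)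
qed

lemma PP_prime:
  assumes Z: "Z \<in> insert X (ZZ X r)"
  shows "PP X r Z \<in> monoid_Spec A"
proof -
  let ?P = "PP X r Z"
  have mem: "cls u \<in> ?P \<longleftrightarrow> set u \<inter> Z \<noteq> {}" if "u \<in> lists X" for u
    using cls_mem_words_meeting[OF Z that] PP_eq_words_meeting[OF Z] by simp
  have sub: "?P \<subseteq> carrier A"
    using PP_eq_words_meeting[OF Z] cls_carrier by auto
  have mult: "a \<otimes>\<^bsub>A\<^esub> b \<in> carrier A" "a \<otimes>\<^bsub>A\<^esub> b \<in> ?P \<longleftrightarrow> a \<in> ?P \<or> b \<in> ?P"
    if "a \<in> carrier A" "b \<in> carrier A" for a b
  proof -
    obtain u where u: "u \<in> lists X" "a = cls u" using \<open>a \<in> carrier A\<close> by (rule carrierE)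
    obtain v where v: "v \<in> lists X" "b = cls v" using \<open>b \<in> carrier A\<close> by (rule carrierE)
    have uv: "u @ v \<in> lists X" "a \<otimes>\<^bsub>A\<^esub> b = cls (u @ v)"
      using u v cls_mult by simp_all
    show "a \<otimes>\<^bsub>A\<^esub> b \<in> carrier A"
      unfolding uv(2) using uv(1) by (rule cls_carrier)
    show "a \<otimes>\<^bsub>A\<^esub> b \<in> ?P \<longleftrightarrow> a \<in> ?P \<or> b \<in> ?P"
      unfolding uv(2) unfolding u(2) v(2) mem[OF uv(1)] mem[OF u(1)] mem[OF v(1)] by auto
  qed
  have Nil: "cls [] \<in> carrier A" "cls [] \<notin> ?P"
    using cls_carrier mem by auto
  have "X \<noteq> {}" using bijective by (simp add: bijective_solution_def ybe_solution_def)
  \<comment> \<open>Nonemptiness of \<open>X\<close> serves the case \<open>Z = X\<close>.\<close>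
  then obtain z where "z \<in> Z" "z \<in> X" using Z by (auto simp: ZZ_def)
  then have "cls [z] \<in> ?P" using mem by simp
  then have proper: "?P \<noteq> {}" "?P \<noteq> carrier A" using Nil by (metis empty_iff, metis)
  have ideal: "monoid_ideal A ?P"
    unfolding monoid_ideal_def
  proof (intro conjI ballI sub)
    fix a p assume a: "a \<in> carrier A" and p: "p \<in> ?P"
    have "p \<in> carrier A" using p sub by (rule rev_subsetD)
    then show "a \<otimes>\<^bsub>A\<^esub> p \<in> ?P" "p \<otimes>\<^bsub>A\<^esub> a \<in> ?P" using a p by (simp_all add: mult(2))
  qed
  have "a \<in> ?P \<or> b \<in> ?P"
    if ab: "a \<in> carrier A" "b \<in> carrier A"
      and incl: "{a \<otimes>\<^bsub>A\<^esub> c \<otimes>\<^bsub>A\<^esub> b | c. c \<in> carrier A} \<subseteq> ?P" for a b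
  proof -
    \<comment> \<open>Taking \<open>c\<close> to be the identity suffices, since the complement of
      \<open>PP X r Z\<close> in \<open>A\<close> is closed under products.\<close>
    have "a \<otimes>\<^bsub>A\<^esub> cls [] \<otimes>\<^bsub>A\<^esub> b \<in> ?P" using incl Nil(1) by blast
    then show ?thesis
      unfolding mult(2)[OF mult(1)[OF ab(1) Nil(1)] ab(2)] mult(2)[OF ab(1) Nil(1)]
      using Nil(2) by simp
  qed
  then show ?thesis
    unfolding monoid_Spec_def monoid_prime_ideal_def mem_Collect_eq
    by (intro conjI ballI impI ideal proper)
qed

lemma PP_XX:
  assumes "P \<in> monoid_Spec A"
  shows "PP X r (XX X r P) = P"
  using PP_eq_words_meeting[OF XX_prime] prime_eq_words_meeting assms by simp

end

theorem proposition3p1: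
  fixes X :: "'a set" and r :: "'a \<times> 'a \<Rightarrow> 'a \<times> 'a"
  assumes "finite X"
    and "bijective_solution X r"
    and "left_nondegenerate X r"
  shows "bij_betw (PP X r) (insert X (ZZ X r)) (monoid_Spec (derived_monoid X r)) \<and>
    bij_betw (XX X r) (monoid_Spec (derived_monoid X r)) (insert X (ZZ X r)) \<and>
    (\<forall>Z \<in> insert X (ZZ X r). XX X r (PP X r Z) = Z) \<and>
    (\<forall>P \<in> monoid_Spec (derived_monoid X r). PP X r (XX X r P) = P)"
proof -
  interpret finite_solution X r using assms by unfold_locales
  have inv: "\<forall>Z \<in> insert X (ZZ X r). XX X r (PP X r Z) = Z"
    "\<forall>P \<in> monoid_Spec A. PP X r (XX X r P) = P"
    using XX_PP PP_XX by blast+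
  have img: "PP X r ` insert X (ZZ X r) \<subseteq> monoid_Spec A"
    "XX X r ` monoid_Spec A \<subseteq> insert X (ZZ X r)"
    using PP_prime XX_prime by blast+
  show ?thesis
    \<comment> \<open>Each map is the witness for the other; swapping the facts gives the reverse
      bijection.\<close>
    by (intro conjI inv bij_betw_byWitness[OF inv img] bij_betw_byWitness[OF inv(2,1) img(2,1)])
qed

end
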